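(* For every integer $n\geq 1$, the $n$-fold Cartesian product $\mathscr{L}^{n}=\mathscr{L}\times\cdots\times\mathscr{L}\subseteq\mathbb{R}^{n}$ of the set $\mathscr{L}$ of Liouville numbers has Hausdorff dimension $n-1$ and packing dimension $n$.
   Context: A real number $\xi\in\mathbb{R}\setminus\mathbb{Q}$ is a Liouville number if for arbitrarily large $N$ the inequality $|\xi-p/q|\leq q^{-N}$ has a solution in rational numbers $p/q$. $\mathscr{L}$ denotes the set of Liouville numbers. Hausdorff and packing dimension are the usual ones on Euclidean space. *)

theory Defs
  imports "HOL-Analysis.Analysis"
begin

section \<open>Liouville numbers\<close>

text \<open>
  The denominator is at least 2: with q = 1 the inequality would be solvable for every
  exponent N and every real number. The condition ``for arbitrarily large N'' is rendered as
  ``for infinitely many natural numbers N''.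
\<close>

definition Liouville_numbers :: "real set" where
  "Liouville_numbers =
     {\<xi>. \<xi> \<notin> \<rat> \<and>
          (\<exists>\<^sub>\<infinity>N::nat. \<exists>p q::int. q \<ge> 2 \<and> \<bar>\<xi> - of_int p / of_int q\<bar> \<le> 1 / of_int q ^ N)}"


section \<open>Hausdorff measure and dimension\<close>

text \<open>
  The convention for exponent 0 is that a nonempty set has gauge 1; it is spelled out because
  \<open>0 powr 0 = 0\<close>.
\<close>

definition diameter_gauge :: "real \<Rightarrow> 'a::metric_space set \<Rightarrow> ennreal" where
  "diameter_gauge s U =
     (if U = {} then 0 else if s = 0 then 1 else ennreal (diameter U powr s))"

text \<open>
  Boundedness has to be required separately, since \<^const>\<open>diameter\<close> is 0 on unbounded sets.
  Members of a cover may be empty, so finite covers are included.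
\<close>

definition delta_covers :: "real \<Rightarrow> 'a::metric_space set \<Rightarrow> (nat \<Rightarrow> 'a set) set" where
  "delta_covers \<delta> A = {U. A \<subseteq> (\<Union>i. U i) \<and> (\<forall>i. bounded (U i) \<and> diameter (U i) \<le> \<delta>)}"

definition hausdorff_premeasure :: "real \<Rightarrow> real \<Rightarrow> 'a::metric_space set \<Rightarrow> ennreal" where
  "hausdorff_premeasure s \<delta> A = (INF U\<in>delta_covers \<delta> A. \<Sum>i. diameter_gauge s (U i))"

definition hausdorff_measure :: "real \<Rightarrow> 'a::metric_space set \<Rightarrow> ennreal" where
  "hausdorff_measure s A = (SUP \<delta>\<in>{0<..}. hausdorff_premeasure s \<delta> A)"

definition hausdorff_dim :: "'a::metric_space set \<Rightarrow> ereal" where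
  "hausdorff_dim A = (INF s\<in>{s. 0 \<le> s \<and> hausdorff_measure s A = 0}. ereal s)"


section \<open>Packing measure and dimension\<close>

text \<open>
  A packing is encoded by its set of pairs (centre, radius). The closed ball of radius r
  contributes \<open>(2 * r) powr s\<close>, which is its diameter to the power s in Euclidean space.
\<close>

definition delta_packings :: "real \<Rightarrow> 'a::metric_space set \<Rightarrow> ('a \<times> real) set set" where
  "delta_packings \<delta> A =
     {C. countable C \<and> C \<subseteq> A \<times> {0<..\<delta>} \<and> disjoint_family_on (\<lambda>(x, r). cball x r) C}"

definition packing_premeasure_delta :: "real \<Rightarrow> real \<Rightarrow> 'a::metric_space set \<Rightarrow> ennreal" where
  "packing_premeasure_delta s \<delta> A =
     (SUP C\<in>delta_packings \<delta> A. \<Sum>\<^sub>\<infinity>(x, r)\<in>C. ennreal ((2 * r) powr s))"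

definition packing_premeasure :: "real \<Rightarrow> 'a::metric_space set \<Rightarrow> ennreal" where
  "packing_premeasure s A = (INF \<delta>\<in>{0<..}. packing_premeasure_delta s \<delta> A)"

text \<open>The premeasure is not countably subadditive, hence the second infimum over covers.\<close>

definition packing_measure :: "real \<Rightarrow> 'a::metric_space set \<Rightarrow> ennreal" where
  "packing_measure s A =
     (INF F\<in>{F :: nat \<Rightarrow> 'a set. A \<subseteq> (\<Union>i. F i)}. \<Sum>i. packing_premeasure s (F i))"

definition packing_dim :: "'a::metric_space set \<Rightarrow> ereal" where
  "packing_dim A = (INF s\<in>{s. 0 \<le> s \<and> packing_measure s A = 0}. ereal s)"

end

theory Submission
  imports Defs
begin

text \<open>
  The Liouville numbers contain a dense \<open>G\<^sub>\<delta>\<close> set, hence so does their power. By Baire, any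
  countable cover of the power has a member that is dense in some ball, and a grid in that ball
  gives packings whose \<open>s\<close>-sums blow up for \<open>s < n\<close>. Baire also shows that finitely many
  translates of the Liouville numbers meet, that is, the Lipschitz map
  \<open>x \<mapsto> (x\<^sub>j - x\<^sub>k)\<close> for \<open>j \<noteq> k\<close> sends the power onto \<open>n - 1\<close>-dimensional space, so the Hausdorff
  dimension is at least \<open>n - 1\<close>. It is at most \<open>n - 1\<close> because one Liouville coordinate suffices:
  cut the slabs of width \<open>2 q\<^sup>-\<^sup>N\<close> around the hyperplanes \<open>x\<^sub>k = p/q\<close> into cubes of side
  \<open>2 q\<^sup>-\<^sup>N\<close> and let \<open>N\<close> tend to infinity.
\<close>

section \<open>Liouville numbers are generic\<close>

text \<open>A solution for an exponent \<open>N'\<close> is also one for every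
  \<open>N \<le> N'\<close> with the same fraction, since \<open>q \<ge> 1\<close>. So unboundedly
  many exponents amount to all of them.\<close>

lemma Liouville_numbers_iff:
  "\<xi> \<in> Liouville_numbers \<longleftrightarrow>
     \<xi> \<notin> \<rat> \<and> (\<forall>N. \<exists>p q::int. q \<ge> 2 \<and> \<bar>\<xi> - of_int p / of_int q\<bar> \<le> 1 / of_int q ^ N)"
proof -
  have "\<exists>p q::int. q \<ge> 2 \<and> \<bar>\<xi> - of_int p / of_int q\<bar> \<le> 1 / of_int q ^ N"
    if inf: "\<exists>\<^sub>\<infinity>N. \<exists>p q::int. q \<ge> 2 \<and> \<bar>\<xi> - of_int p / of_int q\<bar> \<le> 1 / of_int q ^ N" for N
  proof -
    obtain N' p q where *: "N' \<ge> N" "(q::int) \<ge> 2" "\<bar>\<xi> - of_int p / of_int q\<bar> \<le> 1 / of_int q ^ N'"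
      using inf unfolding INFM_nat_le by blast
    have "1 / of_int q ^ N' \<le> 1 / (of_int q ^ N :: real)"
      using *(1,2) by (intro divide_left_mono power_increasing mult_pos_pos zero_less_power) auto
    with * show ?thesis
      by (meson order_trans)
  qed
  thus ?thesis
    unfolding Liouville_numbers_def INFM_nat_le by blast
qed

text \<open>Each \<open>V N\<close> is an open set containing the rationals, hence dense; excluding
  the rationals costs only countably many further dense open sets.\<close>

lemma Liouville_numbers_residual:
  obtains \<G> where "countable \<G>" "\<forall>G\<in>\<G>. open G \<and> closure G = UNIV"
    "\<Inter>\<G> \<subseteq> Liouville_numbers"
proof -
  define V where "V = (\<lambda>N::nat. \<Union>p::int. \<Union>q\<in>{2::int..}. ball (of_int p / of_int q) (1 / of_int q ^ N) :: real set)"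
  define \<G> where "\<G> = range V \<union> (\<lambda>r. - {r}) ` \<rat>"
  show ?thesis
  proof (rule that)
    show "countable \<G>"
      unfolding \<G>_def by (simp add: countable_rat)
  next
    show "\<forall>G\<in>\<G>. open G \<and> closure G = UNIV"
    proof
      fix G assume "G \<in> \<G>"
      then consider N where "G = V N" | r where "G = - {r}"
        unfolding \<G>_def by blast
      thus "open G \<and> closure G = UNIV"
      proof cases
        case 1
        have "\<rat> \<subseteq> V N"
        proof
          fix x :: real assume "x \<in> \<rat>"
          then obtain a b :: int where ab: "b > 0" "x = of_int a / of_int b"
            by (metis Rats_cases')
          \<comment> \<open>Doubling the fraction makes the denominator at least 2, as
            \<open>V N\<close> demands.\<close>
          have "x = of_int (2 * a) / of_int (2 * b)" "2 * b \<ge> 2"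
            using ab by auto
          moreover have "of_int (2 * a) / of_int (2 * b)
              \<in> ball (of_int (2 * a) / of_int (2 * b)) (1 / of_int (2 * b) ^ N :: real)"
            using ab(1) by simp
          ultimately show "x \<in> V N"
            unfolding V_def by blast
        qed
        hence "closure (V N) = UNIV"
          using closure_mono[of \<rat> "V N"] by (simp add: Rats_closure_real top.extremum_unique)
        moreover have "open (V N)"
          unfolding V_def by auto
        ultimately show ?thesis
          using 1 by simp
      next
        case 2
        thus ?thesis
          by (simp add: closure_complement open_Compl)
      qed
    qed
  next
    show "\<Inter>\<G> \<subseteq> Liouville_numbers"
    proof
      fix x assume x: "x \<in> \<Inter>\<G>"
      hence "x \<notin> \<rat>"
        unfolding \<G>_def by blast
      moreover have "\<exists>p q::int. q \<ge> 2 \<and> \<bar>x - of_int p / of_int q\<bar> \<le> 1 / of_int q ^ N" for N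
      proof -
        have "x \<in> V N"
          using x unfolding \<G>_def by blast
        then obtain p q :: int where "q \<ge> 2" "dist (of_int p / of_int q) x < 1 / of_int q ^ N"
          unfolding V_def by auto
        thus ?thesis
          by (intro exI[of _ p] exI[of _ q]) (simp add: dist_real_def abs_minus_commute)
      qed
      ultimately show "x \<in> Liouville_numbers"
        by (simp add: Liouville_numbers_iff)
    qed
  qed
qed

section \<open>Baire category arguments on the line and in the power\<close>

lemma Baire_Inter_nonempty:
  fixes \<G> :: "'a::{real_normed_vector,heine_borel} set set"
  assumes "countable \<G>" "\<And>G. G \<in> \<G> \<Longrightarrow> open G \<and> closure G = UNIV"
  shows "\<Inter>\<G> \<noteq> {}"
  using Baire[of UNIV \<G>] assms by auto

text \<open>Each translate of the Liouville numbers by \<open>- t i\<close> contains a countable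
  intersection of dense open sets, so by Baire these finitely many translates share a point. This
  yields points of the power with prescribed coordinate differences.\<close>

lemma Liouville_numbers_common_translate:
  fixes t :: "'i::finite \<Rightarrow> real"
  obtains z where "\<And>i. z + t i \<in> Liouville_numbers"
proof -
  obtain \<G> where \<G>: "countable \<G>" "\<forall>G\<in>\<G>. open G \<and> closure G = UNIV"
    "\<Inter>\<G> \<subseteq> Liouville_numbers"
    by (rule Liouville_numbers_residual)
  define \<H> where "\<H> = (\<Union>i. (\<lambda>G. (+) (- t i) ` G) ` \<G>)"
  have "\<Inter>\<H> \<noteq> {}"
  proof (rule Baire_Inter_nonempty)
    show "countable \<H>"
      unfolding \<H>_def using \<G>(1) by (intro countable_UN countable_image) auto
    fix H assume "H \<in> \<H>"
    then obtain i G where G: "G \<in> \<G>" "H = (+) (- t i) ` G"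
      unfolding \<H>_def by blast
    have "closure H = (+) (- t i) ` closure G"
      unfolding G(2) by (rule closure_translation)
    moreover have "open H"
      unfolding G(2) using G(1) \<G>(2) by (intro open_translation) blast
    ultimately show "open H \<and> closure H = UNIV"
      using G(1) \<G>(2) surj_plus[of "- t i"] by simp
  qed
  then obtain z where z: "z \<in> \<Inter>\<H>"
    by blast
  have "z + t i \<in> Liouville_numbers" for i
  proof -
    have "z + t i \<in> G" if "G \<in> \<G>" for G
    proof -
      have "z \<in> (+) (- t i) ` G"
        using z that unfolding \<H>_def by blast
      thus ?thesis by auto
    qed
    thus ?thesis
      using \<G>(3) by blast
  qed
  thus ?thesis
    using that by blast
qed

text \<open>Moving only the \<open>i\<close>-th coordinate into \<open>G\<close> displaces
  \<open>x\<close> by exactly the distance moved on the line.\<close>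

lemma closure_vec_nth_vimage:
  fixes G :: "real set" and i :: "'n::finite"
  assumes "closure G = UNIV"
  shows "closure {x :: real ^ 'n. x $ i \<in> G} = UNIV"
proof -
  have "\<exists>y\<in>{x :: real ^ 'n. x $ i \<in> G}. dist y x < e" if e: "e > 0" for e and x :: "real ^ 'n"
  proof -
    have "x $ i \<in> closure G"
      by (simp add: assms)
    then obtain g where g: "g \<in> G" "dist g (x $ i) < e"
      using e unfolding closure_approachable by blast
    define y where "y = x + (g - x $ i) *\<^sub>R axis i 1"
    have "y $ i = g"
      by (simp add: y_def axis_def)
    moreover have "dist y x < e"
      using g(2) by (simp add: y_def dist_norm)
    ultimately show ?thesis
      using g(1) by blast
  qed
  thus ?thesis
    by (auto simp: closure_approachable)
qed

text \<open>If every \<open>closure (F m)\<close> had empty interior, the complements would be dense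
  open sets. Together with the coordinate preimages of \<open>\<G>\<close>, Baire would give a point
  of the power outside all \<open>F m\<close>.\<close>

lemma Liouville_power_nonmeager:
  fixes F :: "nat \<Rightarrow> (real ^ 'n) set"
  assumes "{x. \<forall>i. x $ i \<in> Liouville_numbers} \<subseteq> (\<Union>m. F m)"
  obtains m where "interior (closure (F m)) \<noteq> {}"
proof -
  obtain \<G> where \<G>: "countable \<G>" "\<forall>G\<in>\<G>. open G \<and> closure G = UNIV"
    "\<Inter>\<G> \<subseteq> Liouville_numbers"
    by (rule Liouville_numbers_residual)
  define \<H> where "\<H> = (\<Union>i. (\<lambda>G. {x :: real ^ 'n. x $ i \<in> G}) ` \<G>) \<union> range (\<lambda>m. - closure (F m))"
  show ?thesis
  proof (rule ccontr)
    assume "\<not> thesis"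
    hence nd: "interior (closure (F m)) = {}" for m
      using that by blast
    have "\<Inter>\<H> \<noteq> {}"
    proof (rule Baire_Inter_nonempty)
      show "countable \<H>"
        unfolding \<H>_def using \<G>(1) by (intro countable_UN countable_Un countable_image) auto
      fix H assume "H \<in> \<H>"
      then consider i G where "G \<in> \<G>" "H = {x. x $ i \<in> G}" | m where "H = - closure (F m)"
        unfolding \<H>_def by blast
      thus "open H \<and> closure H = UNIV"
      proof cases
        case 1
        have "open ((\<lambda>x :: real ^ 'n. x $ i) -` G)"
          using \<G>(2) 1(1) by (intro open_vimage continuous_intros) auto
        thus ?thesis
          using 1 \<G>(2) closure_vec_nth_vimage[of G i] by (simp add: vimage_def)
      next
        case 2
        thus ?thesis
          using nd[of m] by (simp add: closure_complement open_Compl)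
      qed
    qed
    then obtain x where x: "x \<in> \<Inter>\<H>"
      by blast
    have "x $ i \<in> \<Inter>\<G>" for i
      using x unfolding \<H>_def by blast
    hence "\<forall>i. x $ i \<in> Liouville_numbers"
      using \<G>(3) by (meson subsetD)
    hence "x \<in> (\<Union>m. F m)"
      by (intro subsetD[OF assms]) simp
    then obtain m where "x \<in> F m"
      by blast
    moreover have "x \<in> - closure (F m)"
      using x unfolding \<H>_def by blast
    ultimately show False
      using closure_subset[of "F m"] by blast
  qed
qed


section \<open>Packing dimension\<close>

text \<open>Disjoint balls centred in \<open>A\<close> with radii at most \<delta> \<le> 1 fit into
  a ball of radius \<open>R + 1\<close>, so volume bounds their sum of \<open>r ^ DIM('a)\<close>.
  The surplus exponent leaves a factor \<open>(2 * \<delta>) powr (s - DIM('a))\<close>, which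
  vanishes with \<delta>.\<close>

lemma packing_premeasure_bounded_eq_0:
  fixes A :: "'a::euclidean_space set" and s :: real
  assumes A: "bounded A" and s: "s > DIM('a)"
  shows "packing_premeasure s A = 0"
proof -
  let ?n = "DIM('a)"
  define \<omega> where "\<omega> = unit_ball_vol (real ?n)"
  have \<omega>: "\<omega> > 0"
    by (simp add: \<omega>_def)
  obtain R where R: "R > 0" "A \<subseteq> ball 0 R"
    using bounded_subset_ballD[OF A] by blast
  \<comment> \<open>\<open>\<omega> * r ^ ?n\<close> is the volume of a ball of radius
    \<open>r\<close>; the factor \<open>2 ^ ?n\<close> passes from radii to diameters.\<close>
  define C where "C = 2 ^ ?n / \<omega> * measure lborel (ball (0::'a) (R + 1))"
  have le: "packing_premeasure_delta s \<delta> A \<le> ennreal (C * (2 * \<delta>) powr (s - ?n))"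
    if \<delta>: "0 < \<delta>" "\<delta> \<le> 1" for \<delta>
    unfolding packing_premeasure_delta_def
  proof (rule SUP_least)
    fix P assume "P \<in> delta_packings \<delta> A"
    hence P: "P \<subseteq> A \<times> {0<..\<delta>}" "disjoint_family_on (\<lambda>(x, r). cball x r) P"
      by (auto simp: delta_packings_def)
    show "(\<Sum>\<^sub>\<infinity>(x, r)\<in>P. ennreal ((2 * r) powr s)) \<le> ennreal (C * (2 * \<delta>) powr (s - ?n))"
    proof (rule infsum_le_finite_sums)
      show "(\<lambda>(x, r). ennreal ((2 * r) powr s)) summable_on P"
        by (rule nonneg_summable_on_complete) auto
      fix T assume T: "finite T" "T \<subseteq> P"
      have disj: "disjoint_family_on (\<lambda>(x, r). cball x r) T"
        using P(2) T(2) by (rule disjoint_family_on_mono[rotated])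
      have rT: "0 < r" "r \<le> \<delta>" "x \<in> A" if "(x, r) \<in> T" for x r
        using that T(2) P(1) by auto
      have "\<omega> * (\<Sum>(x, r)\<in>T. r ^ ?n) = (\<Sum>p\<in>T. measure lborel (case p of (x, r) \<Rightarrow> cball x r))"
        unfolding sum_distrib_left
        by (intro sum.cong refl) (auto simp: content_cball \<omega>_def dest: rT(1))
      also have "\<dots> = measure lborel (\<Union>p\<in>T. case p of (x, r) \<Rightarrow> cball x r)"
        using emeasure_lborel_cball_finite
        by (intro measure_finite_Union[symmetric] T disj) (auto split: prod.splits simp: less_top)
      also have "\<dots> \<le> measure lborel (ball (0::'a) (R + 1))"
      proof (rule measure_mono_fmeasurable)
        show "(\<Union>p\<in>T. case p of (x, r) \<Rightarrow> cball x r) \<subseteq> ball 0 (R + 1)"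
        proof clarsimp
          fix x r y assume "(x, r) \<in> T" "dist x y \<le> r"
          moreover have "norm x < R"
            using rT(3)[OF \<open>(x, r) \<in> T\<close>] R(2) by auto
          ultimately show "norm y < R + 1"
            using rT(2) \<delta> norm_triangle_sub[of y x] by (fastforce simp: dist_norm norm_minus_commute)
        qed
        show "(\<Union>p\<in>T. case p of (x, r) \<Rightarrow> cball x r) \<in> sets lborel"
          using T(1) by (intro sets.finite_UN) auto
        show "ball (0::'a) (R + 1) \<in> fmeasurable lborel"
          using emeasure_lborel_ball_finite[of "0::'a" "R + 1"] by (auto simp: fmeasurable_def)
      qed
      finally have vol: "2 ^ ?n * (\<Sum>(x, r)\<in>T. r ^ ?n) \<le> C"
        using \<omega> by (simp add: C_def field_simps)
      have "(\<Sum>(x, r)\<in>T. ennreal ((2 * r) powr s)) = ennreal (\<Sum>(x, r)\<in>T. (2 * r) powr s)"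
        by (subst sum_ennreal[symmetric]) (auto intro!: sum.cong)
      also have "(\<Sum>(x, r)\<in>T. (2 * r) powr s)
          \<le> (\<Sum>(x, r)\<in>T. (2 * \<delta>) powr (s - ?n) * (2 ^ ?n * r ^ ?n))"
      proof (rule sum_mono, clarify)
        fix x r assume "(x, r) \<in> T"
        note r = rT(1,2)[OF this]
        have "(2 * r) powr s = (2 * r) powr (s - ?n) * (2 * r) ^ ?n"
          using r by (simp add: powr_diff powr_realpow)
        also have "\<dots> \<le> (2 * \<delta>) powr (s - ?n) * (2 * r) ^ ?n"
          using r s by (intro mult_right_mono powr_mono2) auto
        finally show "(2 * r) powr s \<le> (2 * \<delta>) powr (s - ?n) * (2 ^ ?n * r ^ ?n)"
          by (simp add: power_mult_distrib)
      qed
      also have "\<dots> = (2 * \<delta>) powr (s - ?n) * (2 ^ ?n * (\<Sum>(x, r)\<in>T. r ^ ?n))"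
        by (simp add: sum_distrib_left case_prod_unfold)
      also have "\<dots> \<le> (2 * \<delta>) powr (s - ?n) * C"
        using vol by (intro mult_left_mono) auto
      finally show "(\<Sum>(x, r)\<in>T. ennreal ((2 * r) powr s)) \<le> ennreal (C * (2 * \<delta>) powr (s - ?n))"
        by (simp add: ennreal_leI mult.commute)
    qed
  qed
  have "packing_premeasure s A \<le> ennreal (C * (2 * inverse (real (Suc k))) powr (s - ?n))" for k
    unfolding packing_premeasure_def
    by (rule INF_lower2[of "inverse (real (Suc k))"], simp, rule le) (simp_all add: inverse_le_1_iff)
  \<comment> \<open>The limit is 0: the exponent is positive, and
    \<open>0 powr a = 0\<close>.\<close>
  moreover have "(\<lambda>k. ennreal (C * (2 * inverse (real (Suc k))) powr (s - ?n))) \<longlonglongrightarrow> ennreal (C * (2 * 0) powr (s - ?n))"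
    using s by (intro tendsto_ennrealI tendsto_intros LIMSEQ_inverse_real_of_nat tendsto_powr') auto
  ultimately have "packing_premeasure s A \<le> ennreal (C * (2 * 0) powr (s - ?n))"
    by (intro LIMSEQ_le_const) auto
  thus ?thesis
    by simp
qed

text \<open>The packing measure may split \<open>A\<close> into countably many pieces, so it is
  enough that each bounded piece has premeasure 0.\<close>

lemma packing_measure_eq_0:
  fixes A :: "'a::euclidean_space set" and s :: real
  assumes "s > DIM('a)"
  shows "packing_measure s A = 0"
proof -
  have "A \<subseteq> (\<Union>i. A \<inter> ball 0 (real i))"
    using reals_Archimedean2 by fastforce
  hence "packing_measure s A \<le> (\<Sum>i. packing_premeasure s (A \<inter> ball 0 (real i)))"
    unfolding packing_measure_def by (intro INF_lower) auto
  also have "\<dots> = 0"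
    using assms by (simp add: packing_premeasure_bounded_eq_0 bounded_Int)
  finally show ?thesis
    by simp
qed

lemma packing_dim_le_DIM:
  fixes A :: "'a::euclidean_space set"
  shows "packing_dim A \<le> DIM('a)"
  unfolding packing_dim_def
proof (rule ereal_le_epsilon2)
  fix e :: real assume "e > 0"
  hence "(INF s\<in>{s. 0 \<le> s \<and> packing_measure s A = 0}. ereal s) \<le> ereal (DIM('a) + e)"
    by (intro INF_lower) (auto simp: packing_measure_eq_0)
  thus "(INF s\<in>{s. 0 \<le> s \<and> packing_measure s A = 0}. ereal s) \<le> ereal (DIM('a)) + ereal e"
    by simp
qed

section \<open>Lower bound for the packing dimension\<close>

text \<open>The \<open>k ^ CARD('n)\<close> points of a grid in the ball are moved slightly into
  \<open>F\<close>; balls around the moved points, with a quarter of the grid spacing as radius,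
  stay disjoint.\<close>

lemma packing_premeasure_delta_ge_grid:
  fixes F :: "(real ^ 'n) set"
  assumes F: "ball c \<rho> \<subseteq> closure F" and \<rho>: "\<rho> > 0" and k: "k > 0"
    and \<delta>: "\<rho> / (8 * real CARD('n) * real k) \<le> \<delta>"
  shows "ennreal (real k ^ CARD('n) * (\<rho> / (4 * real CARD('n) * real k)) powr s) \<le> packing_premeasure_delta s \<delta> F"
proof -
  let ?n = "real CARD('n)"
  \<comment> \<open>With this spacing the coordinates of a grid offset sum to at most
    \<open>?n * h * k = \<rho> / 2\<close>, which keeps the grid inside the ball. The packing radius
    \<open>h / 4\<close> is the quantity that the hypothesis bounds by \<delta>.\<close>
  define h where "h = \<rho> / (2 * ?n * k)"
  have n: "?n > 0"
    by simp
  have h: "h > 0"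
    using \<rho> k n by (simp add: h_def)
  define G where "G = (UNIV :: 'n set) \<rightarrow>\<^sub>E {..<k}"
  have fin: "finite G" and card: "card G = k ^ CARD('n)"
    by (simp_all add: G_def finite_PiE card_funcsetE)
  define pt :: "('n \<Rightarrow> nat) \<Rightarrow> real ^ 'n" where "pt = (\<lambda>g. c + (\<chi> i. h * g i))"
  have "pt g \<in> ball c \<rho>" if "g \<in> G" for g
  proof -
    have "norm (\<chi> i. h * g i :: real ^ 'n) \<le> (\<Sum>i\<in>UNIV. \<bar>(\<chi> i. h * g i :: real ^ 'n) $ i\<bar>)"
      by (rule norm_le_l1_cart)
    also have "\<dots> \<le> (\<Sum>i\<in>(UNIV::'n set). h * k)"
      using that h by (intro sum_mono) (auto simp: G_def PiE_def Pi_def less_imp_le)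
    also have "\<dots> = \<rho> / 2"
      using k n by (simp add: h_def field_simps)
    finally show ?thesis
      using \<rho> by (simp add: pt_def dist_norm)
  qed
  hence "\<exists>x\<in>F. dist x (pt g) < h / 8" if "g \<in> G" for g
    using that F h closure_approachable[of "pt g" F] by (metis divide_pos_pos subsetD zero_less_numeral)
  then obtain f where f: "\<And>g. g \<in> G \<Longrightarrow> f g \<in> F \<and> dist (f g) (pt g) < h / 8"
    by metis
  \<comment> \<open>Distinct grid points are at least \<open>h\<close> apart and each moves by less
    than \<open>h / 8\<close>. The remaining \<open>3 / 4 * h\<close> exceeds the
    \<open>h / 2\<close> that two balls of radius \<open>h / 4\<close> occupy.\<close>
  have sep: "dist (f g) (f g') \<ge> 3 / 4 * h" if g: "g \<in> G" "g' \<in> G" "g \<noteq> g'" for g g'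
  proof -
    obtain i where i: "g i \<noteq> g' i"
      using g(3) by blast
    have "h * 1 \<le> h * \<bar>real (g i) - real (g' i)\<bar>"
      using i h by (intro mult_left_mono) auto
    also have "\<dots> = \<bar>(pt g - pt g') $ i\<bar>"
      using h by (simp add: pt_def abs_mult flip: right_diff_distrib)
    also have "\<dots> \<le> dist (pt g) (pt g')"
      unfolding dist_norm by (rule component_le_norm_cart)
    finally show ?thesis
      using f[OF g(1)] f[OF g(2)] dist_triangle[of "pt g" "pt g'" "f g"]
        dist_triangle[of "f g" "pt g'" "f g'"] by (simp add: dist_commute)
  qed
  define P where "P = (\<lambda>g. (f g, h / 4)) ` G"
  have inj: "inj_on (\<lambda>g. (f g, h / 4)) G"
    using sep h by (force intro!: inj_onI)
  have "P \<in> delta_packings \<delta> F"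
    unfolding delta_packings_def
  proof (intro CollectI conjI)
    show "countable P"
      using fin by (simp add: P_def countable_finite)
    show "P \<subseteq> F \<times> {0<..\<delta>}"
      using f h \<delta> by (auto simp: P_def h_def field_simps)
    show "disjoint_family_on (\<lambda>(x, r). cball x r) P"
      unfolding disjoint_family_on_def
    proof (intro ballI impI)
      fix p p' assume "p \<in> P" "p' \<in> P" "p \<noteq> p'"
      then obtain g g' where g: "g \<in> G" "g' \<in> G" "g \<noteq> g'" "p = (f g, h / 4)" "p' = (f g', h / 4)"
        unfolding P_def by blast
      have "cball (f g) (h / 4) \<inter> cball (f g') (h / 4) = {}"
        using sep[OF g(1-3)] h by (intro disjoint_cballI) auto
      thus "(case p of (x, r) \<Rightarrow> cball x r) \<inter> (case p' of (x, r) \<Rightarrow> cball x r) = {}"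
        by (simp add: g)
    qed
  qed
  hence "(\<Sum>\<^sub>\<infinity>(x, r)\<in>P. ennreal ((2 * r) powr s)) \<le> packing_premeasure_delta s \<delta> F"
    unfolding packing_premeasure_delta_def by (rule SUP_upper)
  moreover have "(\<Sum>\<^sub>\<infinity>(x, r)\<in>P. ennreal ((2 * r) powr s)) = (\<Sum>g\<in>G. ennreal ((h / 2) powr s))"
    using fin inj by (simp add: P_def sum.reindex)
  moreover have "\<dots> = ennreal (real k ^ CARD('n) * (\<rho> / (4 * ?n * k)) powr s)"
    by (simp add: card h_def ennreal_mult mult.assoc flip: ennreal_of_nat_eq_real_of_nat)
       (metis ennreal_of_nat_eq_real_of_nat ennreal_power of_nat_0_le_iff of_nat_power)
  ultimately show ?thesis
    by simp
qed

text \<open>The grid packings sum to a positive constant times \<open>real k powr (?n - s)\<close>,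
  unbounded in \<open>k\<close>, while their radii shrink below any \<delta>.\<close>

lemma packing_premeasure_somewhere_dense_ge_1:
  fixes F :: "(real ^ 'n) set" and s :: real
  assumes F: "interior (closure F) \<noteq> {}" and s: "s < CARD('n)"
  shows "packing_premeasure s F \<ge> 1"
  unfolding packing_premeasure_def
proof (rule INF_greatest, clarsimp)
  fix \<delta> :: real assume \<delta>: "\<delta> > 0"
  obtain c \<rho> where \<rho>: "\<rho> > 0" "ball c \<rho> \<subseteq> closure F"
    using F by (meson equals0I mem_interior)
  let ?n = "real CARD('n)"
  define C where "C = (\<rho> / (4 * ?n)) powr s"
  have C: "C > 0"
    using \<rho> by (simp add: C_def)
  have "filterlim (\<lambda>k::nat. C * real k powr (?n - s)) at_top sequentially"
    using s C by (intro filterlim_tendsto_pos_mult_at_top[OF tendsto_const C]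
        filterlim_compose[OF real_powr_at_top] filterlim_real_sequentially) auto
  hence "eventually (\<lambda>k::nat. 1 \<le> C * real k powr (?n - s)) sequentially"
    by (simp add: filterlim_at_top)
  moreover have "(\<lambda>k. \<rho> / (8 * ?n) / real k) \<longlonglongrightarrow> 0"
    by (rule lim_const_over_n)
  hence "eventually (\<lambda>k. \<rho> / (8 * ?n) / real k < \<delta>) sequentially"
    using \<delta> by (rule order_tendstoD)
  ultimately have "eventually (\<lambda>k. 1 \<le> C * real k powr (?n - s) \<and> \<rho> / (8 * ?n) / real k < \<delta> \<and> k > 0) sequentially"
    using eventually_gt_at_top[of 0] by eventually_elim auto
  then obtain k where k: "1 \<le> C * real k powr (?n - s)" "\<rho> / (8 * ?n) / real k < \<delta>" "k > 0"
    using eventually_happens by force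
  have "C * real k powr (?n - s) = real k ^ CARD('n) * (\<rho> / (4 * ?n * k)) powr s"
    using \<rho> k(3) by (simp add: C_def powr_diff powr_realpow powr_divide powr_mult)
  moreover have "ennreal (real k ^ CARD('n) * (\<rho> / (4 * ?n * k)) powr s) \<le> packing_premeasure_delta s \<delta> F"
    using \<rho> k by (intro packing_premeasure_delta_ge_grid) auto
  ultimately show "1 \<le> packing_premeasure_delta s \<delta> F"
    using k(1) by (metis ennreal_leI ennreal_1 order_trans)
qed

lemma packing_dim_Liouville_power:
  "packing_dim {x :: real ^ 'n. \<forall>i. x $ i \<in> Liouville_numbers} = ereal (real CARD('n))"
proof (rule antisym)
  show "packing_dim {x :: real ^ 'n. \<forall>i. x $ i \<in> Liouville_numbers} \<le> ereal (real CARD('n))"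
    using packing_dim_le_DIM[where 'a = "real ^ 'n"] by simp
  show "ereal (real CARD('n)) \<le> packing_dim {x :: real ^ 'n. \<forall>i. x $ i \<in> Liouville_numbers}"
    unfolding packing_dim_def
  proof (rule INF_greatest, clarsimp, rule ccontr)
    fix s
    assume 0: "packing_measure s {x :: real ^ 'n. \<forall>i. x $ i \<in> Liouville_numbers} = 0"
      and s: "\<not> real CARD('n) \<le> s"
    \<comment> \<open>Measure 0 would give a cover of total premeasure below 1, but a member dense
      in some ball alone contributes at least 1.\<close>
    have "packing_measure s {x :: real ^ 'n. \<forall>i. x $ i \<in> Liouville_numbers} < 1"
      by (simp add: 0)
    then obtain F where F: "{x :: real ^ 'n. \<forall>i. x $ i \<in> Liouville_numbers} \<subseteq> (\<Union>i. F i)"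
        "(\<Sum>i. packing_premeasure s (F i)) < 1"
      unfolding packing_measure_def INF_less_iff by blast
    obtain m where "interior (closure (F m)) \<noteq> {}"
      using Liouville_power_nonmeager[OF F(1)] .
    hence "packing_premeasure s (F m) \<ge> 1"
      using s by (intro packing_premeasure_somewhere_dense_ge_1) auto
    moreover have "packing_premeasure s (F m) < 1"
      using F(2) by (rule ennreal_suminf_lessD)
    ultimately show False
      by simp
  qed
qed

section \<open>Hausdorff dimension\<close>

lemma hausdorff_premeasure_mono:
  "A \<subseteq> B \<Longrightarrow> hausdorff_premeasure s \<delta> A \<le> hausdorff_premeasure s \<delta> B"
  unfolding hausdorff_premeasure_def delta_covers_def by (intro INF_superset_mono) auto

lemma hausdorff_premeasure_le_gauge:
  assumes "bounded A" "diameter A \<le> \<delta>" "\<delta> \<ge> 0"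
  shows "hausdorff_premeasure s \<delta> A \<le> diameter_gauge s A"
proof -
  \<comment> \<open>The padding sets are empty, so their gauge is 0 even at exponent 0.\<close>
  define U :: "nat \<Rightarrow> 'a set" where "U = (\<lambda>i. if i = 0 then A else {})"
  have "U \<in> delta_covers \<delta> A"
    using assms by (auto simp: delta_covers_def U_def)
  hence "hausdorff_premeasure s \<delta> A \<le> (\<Sum>i. diameter_gauge s (U i))"
    unfolding hausdorff_premeasure_def by (rule INF_lower)
  also have "\<dots> = (\<Sum>i\<in>{0}. diameter_gauge s (U i))"
    by (rule suminf_finite) (auto simp: U_def diameter_gauge_def)
  finally show ?thesis
    by (simp add: U_def)
qed

text \<open>Covers of the \<open>A m\<close> that are optimal up to
  \<open>e * (1 / 2) ^ Suc m\<close> are merged along the pairing bijection. They exist because each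
  premeasure is finite, which \<open>ennreal_le_epsilon\<close> allows to assume.\<close>

lemma hausdorff_premeasure_UN_le_suminf:
  fixes A :: "nat \<Rightarrow> 'a::metric_space set"
  shows "hausdorff_premeasure s \<delta> (\<Union>m. A m) \<le> (\<Sum>m. hausdorff_premeasure s \<delta> (A m))"
proof (rule ennreal_le_epsilon)
  fix e :: real
  assume fin: "(\<Sum>m. hausdorff_premeasure s \<delta> (A m)) < top" and e: "e > 0"
  have "\<exists>U\<in>delta_covers \<delta> (A m).
      (\<Sum>i. diameter_gauge s (U i)) < hausdorff_premeasure s \<delta> (A m) + ennreal (e * (1 / 2) ^ Suc m)" for m
  proof -
    have "hausdorff_premeasure s \<delta> (A m) < hausdorff_premeasure s \<delta> (A m) + ennreal (e * (1 / 2) ^ Suc m)"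
      using ennreal_suminf_lessD[OF fin, of m] e by (simp add: ennreal_add_left_cancel_less[where b = 0, simplified])
    thus ?thesis
      by (subst (asm) (1) hausdorff_premeasure_def) (simp add: INF_less_iff)
  qed
  then obtain U where U: "\<And>m. U m \<in> delta_covers \<delta> (A m)"
    "\<And>m. (\<Sum>i. diameter_gauge s (U m i)) < hausdorff_premeasure s \<delta> (A m) + ennreal (e * (1 / 2) ^ Suc m)"
    by metis
  define W where "W = (\<lambda>p. case prod_decode p of (m, i) \<Rightarrow> U m i)"
  have "W \<in> delta_covers \<delta> (\<Union>m. A m)"
    unfolding delta_covers_def
  proof (intro CollectI conjI allI)
    show "(\<Union>m. A m) \<subseteq> (\<Union>p. W p)"
    proof
      fix x assume "x \<in> (\<Union>m. A m)"
      then obtain m i where "x \<in> U m i"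
        using U(1) unfolding delta_covers_def by blast
      hence "x \<in> W (prod_encode (m, i))"
        by (simp add: W_def)
      thus "x \<in> (\<Union>p. W p)"
        by blast
    qed
    show "bounded (W p)" "diameter (W p) \<le> \<delta>" for p
      using U(1) by (auto simp: W_def delta_covers_def split: prod.splits)
  qed
  hence "hausdorff_premeasure s \<delta> (\<Union>m. A m) \<le> (\<Sum>p. diameter_gauge s (W p))"
    unfolding hausdorff_premeasure_def by (rule INF_lower)
  also have "\<dots> = (\<Sum>p. (\<lambda>(m, i). diameter_gauge s (U m i)) (prod_decode p))"
    by (simp add: W_def case_prod_unfold)
  also have "\<dots> = (\<Sum>m. \<Sum>i. diameter_gauge s (U m i))"
    by (rule suminf_ennreal_2dimen) simp
  also have "\<dots> \<le> (\<Sum>m. hausdorff_premeasure s \<delta> (A m) + ennreal (e * (1 / 2) ^ Suc m))"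
    using U(2) by (intro suminf_le) (auto intro: less_imp_le)
  also have "\<dots> = (\<Sum>m. hausdorff_premeasure s \<delta> (A m)) + (\<Sum>m. ennreal (e * (1 / 2) ^ Suc m))"
    by (rule suminf_add[symmetric]) auto
  also have "(\<Sum>m. ennreal (e * (1 / 2) ^ Suc m)) = ennreal e"
    using e sums_mult[OF power_half_series, of e] by (intro suminf_ennreal_eq) auto
  finally show "hausdorff_premeasure s \<delta> (\<Union>m. A m) \<le> (\<Sum>m. hausdorff_premeasure s \<delta> (A m)) + ennreal e" .
qed

lemma hausdorff_premeasure_empty:
  assumes "\<delta> \<ge> 0"
  shows "hausdorff_premeasure s \<delta> {} = 0"
  using hausdorff_premeasure_le_gauge[of "{}" \<delta> s] assms by (simp add: diameter_gauge_def)

lemma hausdorff_premeasure_UN_le_sum: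
  fixes A :: "'i \<Rightarrow> 'a::metric_space set"
  assumes I: "finite I" and \<delta>: "\<delta> \<ge> 0"
  shows "hausdorff_premeasure s \<delta> (\<Union>i\<in>I. A i) \<le> (\<Sum>i\<in>I. hausdorff_premeasure s \<delta> (A i))"
proof -
  obtain h where h: "bij_betw h {..<card I} I"
    using ex_bij_betw_nat_finite[OF I] by (auto simp: atLeast0LessThan)
  define B where "B = (\<lambda>j. if j < card I then A (h j) else {})"
  have "(\<Union>i\<in>I. A i) = (\<Union>j\<in>{..<card I}. A (h j))"
    using image_image[of A h "{..<card I}"] unfolding bij_betw_imp_surj_on[OF h] by (rule arg_cong)
  also have "\<dots> = (\<Union>j. B j)"
    by (auto simp: B_def split: if_splits)
  finally have "hausdorff_premeasure s \<delta> (\<Union>i\<in>I. A i) \<le> (\<Sum>j. hausdorff_premeasure s \<delta> (B j))"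
    using hausdorff_premeasure_UN_le_suminf[of s \<delta> B] by simp
  also have "\<dots> = (\<Sum>j<card I. hausdorff_premeasure s \<delta> (B j))"
    using \<delta> by (intro suminf_finite) (auto simp: B_def hausdorff_premeasure_empty)
  also have "\<dots> = (\<Sum>i\<in>I. hausdorff_premeasure s \<delta> (A i))"
    using sum.reindex_bij_betw[OF h, of "\<lambda>i. hausdorff_premeasure s \<delta> (A i)"] by (simp add: B_def)
  finally show ?thesis .
qed

section \<open>Upper bound for the Hausdorff dimension\<close>

text \<open>The slab has width \<open>2 / m\<close>, so cutting it into cubes of that side means
  subdividing only the directions other than \<open>k\<close>. The l1 norm bounds the diameter of a
  cube by \<open>2 * CARD('n) / m\<close>.\<close>

lemma hausdorff_premeasure_slab_le:
  fixes k :: "'n::finite" and a s \<delta> :: real and m M :: nat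
  assumes m: "m > 0" and M: "M > 0" and s: "s > 0" and \<delta>: "2 * CARD('n) / m \<le> \<delta>"
  shows "hausdorff_premeasure s \<delta> {x :: real ^ 'n. \<bar>x $ k - a\<bar> \<le> 1 / m \<and> (\<forall>i. \<bar>x $ i\<bar> \<le> M)}
           \<le> ennreal (real (2 * M * m) ^ (CARD('n) - 1) * (2 * CARD('n) / m) powr s)"
proof -
  define G where "G = (UNIV - {k}) \<rightarrow>\<^sub>E {..<2 * M * m}"
  have fin: "finite G" and card: "card G = (2 * M * m) ^ (CARD('n) - 1)"
    by (simp_all add: G_def finite_PiE card_funcsetE)
  \<comment> \<open>\<open>g i\<close> numbers the interval of length \<open>2 / m\<close>, counted
    from \<open>- M\<close>, in which \<open>x $ i\<close> lies.\<close>
  define Q :: "('n \<Rightarrow> nat) \<Rightarrow> (real ^ 'n) set" where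
    "Q = (\<lambda>g. {x. \<bar>x $ k - a\<bar> \<le> 1 / m \<and> (\<forall>i. i \<noteq> k \<longrightarrow> g i \<le> (x $ i + M) * m / 2 \<and> (x $ i + M) * m / 2 \<le> g i + 1)})"
  have \<delta>0: "\<delta> \<ge> 0"
    by (rule order_trans[OF _ \<delta>]) simp
  have dist_Q: "norm (x - y) \<le> 2 * CARD('n) / m" if x: "x \<in> Q g" and y: "y \<in> Q g" for x y g
  proof -
    have "\<bar>(x - y) $ i\<bar> \<le> 2 / m" for i
    proof (cases "i = k")
      case True
      have "\<bar>x $ k - a\<bar> \<le> 1 / m" "\<bar>y $ k - a\<bar> \<le> 1 / m"
        using x y by (auto simp: Q_def)
      moreover have "2 / real m = 1 / m + 1 / m"
        by simp
      ultimately show ?thesis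
        unfolding True vector_minus_component by linarith
    next
      case False
      have "g i \<le> (x $ i + M) * m / 2" "(x $ i + M) * m / 2 \<le> g i + 1"
        "g i \<le> (y $ i + M) * m / 2" "(y $ i + M) * m / 2 \<le> g i + 1"
        using x y False by (auto simp: Q_def)
      hence "\<bar>(x $ i + M) * m / 2 - (y $ i + M) * m / 2\<bar> \<le> 1"
        by linarith
      also have "(x $ i + M) * m / 2 - (y $ i + M) * m / 2 = (x - y) $ i * (m / 2)"
        by (simp add: field_simps)
      finally show ?thesis
        using m unfolding abs_mult by (simp add: pos_le_divide_eq)
    qed
    hence "(\<Sum>i\<in>UNIV. \<bar>(x - y) $ i\<bar>) \<le> (\<Sum>i\<in>(UNIV::'n set). 2 / real m)"
      by (intro sum_mono)
    thus ?thesis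
      using norm_le_l1_cart[of "x - y"] by (simp add: field_simps)
  qed
  have Q: "hausdorff_premeasure s \<delta> (Q g) \<le> ennreal ((2 * CARD('n) / m) powr s)" for g
  proof -
    have diam: "diameter (Q g) \<le> 2 * CARD('n) / m"
      using dist_Q by (intro diameter_le) auto
    have bd: "bounded (Q g)"
      using dist_Q unfolding bounded_two_points by (auto simp: dist_norm)
    have "hausdorff_premeasure s \<delta> (Q g) \<le> diameter_gauge s (Q g)"
      by (rule hausdorff_premeasure_le_gauge[OF bd order_trans[OF diam \<delta>] \<delta>0])
    also have "\<dots> \<le> ennreal ((2 * CARD('n) / m) powr s)"
      using diam s diameter_ge_0[OF bd] by (auto simp: diameter_gauge_def intro!: ennreal_leI powr_mono2)
    finally show ?thesis .
  qed
  have "{x. \<bar>x $ k - a\<bar> \<le> 1 / m \<and> (\<forall>i. \<bar>x $ i\<bar> \<le> M)} \<subseteq> (\<Union>g\<in>G. Q g)"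
  proof clarify
    fix x :: "real ^ 'n" assume x: "\<bar>x $ k - a\<bar> \<le> 1 / m" "\<forall>i. \<bar>x $ i\<bar> \<le> M"
    define g where "g = (\<lambda>i\<in>UNIV - {k}. nat \<lfloor>(x $ i + M) * m / 2\<rfloor>)"
    have g: "real (g i) \<le> (x $ i + M) * m / 2" "(x $ i + M) * m / 2 \<le> real (g i) + 1" "g i < 2 * M * m"
      if "i \<noteq> k" for i
    proof -
      have xi: "0 \<le> x $ i + M" "x $ i + M \<le> 2 * M"
        using spec[OF x(2), of i] by linarith+
      hence nn: "0 \<le> (x $ i + M) * m / 2"
        by simp
      have "real (g i) = of_int \<lfloor>(x $ i + M) * m / 2\<rfloor>"
        using that nn by (simp add: g_def)
      thus le: "real (g i) \<le> (x $ i + M) * m / 2" "(x $ i + M) * m / 2 \<le> real (g i) + 1"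
        by linarith+
      \<comment> \<open>The value \<open>M * m\<close> is attained at \<open>x $ i = M\<close>;
        allowing \<open>2 * M * m\<close> indices makes the inequality strict at this end point
        too.\<close>
      have "(x $ i + M) * m / 2 \<le> 2 * M * m / 2"
        using xi m by (intro divide_right_mono mult_right_mono) auto
      also have "\<dots> < real (2 * M * m)"
        using m M by simp
      finally show "g i < 2 * M * m"
        using le(1) by linarith
    qed
    have "g \<in> G"
      using g(3) by (auto simp: G_def g_def)
    moreover have "x \<in> Q g"
      using x(1) g(1,2) by (auto simp: Q_def)
    ultimately show "x \<in> (\<Union>g\<in>G. Q g)"
      by blast
  qed
  hence "hausdorff_premeasure s \<delta> {x :: real ^ 'n. \<bar>x $ k - a\<bar> \<le> 1 / m \<and> (\<forall>i. \<bar>x $ i\<bar> \<le> M)}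
      \<le> hausdorff_premeasure s \<delta> (\<Union>g\<in>G. Q g)"
    by (rule hausdorff_premeasure_mono)
  also have "\<dots> \<le> (\<Sum>g\<in>G. hausdorff_premeasure s \<delta> (Q g))"
    by (rule hausdorff_premeasure_UN_le_sum[OF fin \<delta>0])
  also have "\<dots> \<le> (\<Sum>g\<in>G. ennreal ((2 * CARD('n) / m) powr s))"
    by (intro sum_mono Q)
  also have "\<dots> = ennreal (\<Sum>g\<in>G. (2 * CARD('n) / m) powr s)"
    by (rule sum_ennreal) simp
  finally show ?thesis
    by (simp add: card)
qed

text \<open>For any single exponent \<open>N\<close>, the slabs of all denominators
  \<open>q \<ge> 2\<close> cover the set. With \<open>m = q ^ N\<close>, there are of the order of
  \<open>q\<close> slabs for \<open>q\<close>, each costing a multiple of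
  \<open>m powr (- t)\<close>. The smallness comes from a large \<open>N\<close>, not from a tail in
  \<open>q\<close>.\<close>

lemma hausdorff_premeasure_Liouville_box_eq_0:
  fixes k :: "'n::finite" and M :: nat
  assumes s: "s > real CARD('n) - 1" and \<delta>: "\<delta> > 0" and M: "M > 0"
  shows "hausdorff_premeasure s \<delta> {x :: real ^ 'n. x $ k \<in> Liouville_numbers \<and> (\<forall>i. \<bar>x $ i\<bar> \<le> M)} = 0"
proof -
  let ?n = "CARD('n)"
  define t where "t = s - real (?n - 1)"
  have n: "?n \<ge> 1"
    by (simp add: Suc_leI)
  have n': "real ?n \<ge> 1"
    using n by linarith
  have t: "t > 0" and s0: "s > 0" and st: "s = t + real (?n - 1)"
    using s n' unfolding t_def of_nat_diff[OF n] by linarith+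
  \<comment> \<open>The factors come from the number of numerators, at most
    \<open>(2 * M + 3) * q\<close>, from the number of cubes in a slab and from their
    diameters.\<close>
  define C where "C = (2 * M + 3) * (2 * M) ^ (?n - 1) * (2 * ?n) powr s"
  have C: "C \<ge> 0"
    by (simp add: C_def)
  define S where "S = (\<Sum>j. 1 / (real j + 2) ^ 2)"
  have "summable (\<lambda>j. inverse (real (j + 2) ^ 2))"
    using inverse_power_summable[where 'a = real, of 2] summable_iff_shift[of "\<lambda>j. inverse (real j ^ 2)" 2] by simp
  hence S: "(\<lambda>j. 1 / (real j + 2) ^ 2) sums S"
    unfolding S_def by (intro summable_sums) (simp add: inverse_eq_divide add.commute)
  let ?L = "{x :: real ^ 'n. x $ k \<in> Liouville_numbers \<and> (\<forall>i. \<bar>x $ i\<bar> \<le> M)}"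
  have "hausdorff_premeasure s \<delta> ?L \<le> ennreal (C * (1 / 2) ^ K * S)" for K
  proof -
    \<comment> \<open>\<open>N1\<close> makes \<open>N * t\<close> at least \<open>K + 3\<close>;
      \<open>N2\<close> brings the diameter bound below \<delta> for all \<open>q \<ge> 2\<close> at
      once.\<close>
    obtain N1 :: nat where N1: "real N1 > (K + 3) / t"
      using reals_Archimedean2 by blast
    obtain N2 :: nat where N2: "(1 / 2) ^ N2 < \<delta> / (2 * ?n)"
      using real_arch_pow_inv[of "\<delta> / (2 * ?n)" "1 / 2"] \<delta> by auto
    define N where "N = max N1 N2"
    have N: "real N * t \<ge> real (K + 3)"
    proof -
      have "(K + 3) / t \<le> real N"
        using N1 by (simp add: N_def)
      thus ?thesis
        using t by (simp add: pos_divide_le_eq)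
    qed
    have N\<delta>: "2 * ?n / real (q ^ N) \<le> \<delta>" if "q \<ge> 2" for q :: nat
    proof -
      have "(2::real) ^ N2 \<le> 2 ^ N"
        by (intro power_increasing) (auto simp: N_def)
      also have "\<dots> \<le> real q ^ N"
        using that by (intro power_mono) auto
      finally have "1 / real q ^ N \<le> 1 / 2 ^ N2"
        by (intro divide_left_mono) (use that in auto)
      hence "1 / real q ^ N \<le> \<delta> / (2 * ?n)"
        using N2 by (simp add: power_divide)
      hence "2 * ?n * (1 / real q ^ N) \<le> 2 * ?n * (\<delta> / (2 * ?n))"
        by (intro mult_left_mono) auto
      thus ?thesis
        using n by simp
    qed
    define slab where "slab = (\<lambda>(q::nat) (p::int).
        {x :: real ^ 'n. \<bar>x $ k - of_int p / real q\<bar> \<le> 1 / real (q ^ N) \<and> (\<forall>i. \<bar>x $ i\<bar> \<le> M)})"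
    \<comment> \<open>As \<open>\<bar>x $ k\<bar> \<le> M\<close> and the approximation error is at
      most 1, the numerators are at most \<open>(M + 1) * q\<close> in absolute value.\<close>
    define P where "P = (\<lambda>q::nat. {- (int (M + 1) * int q)..int (M + 1) * int q})"
    have cover: "?L \<subseteq> (\<Union>j. \<Union>p\<in>P (j + 2). slab (j + 2) p)"
    proof clarify
      fix x :: "real ^ 'n" assume x: "x $ k \<in> Liouville_numbers" "\<forall>i. \<bar>x $ i\<bar> \<le> M"
      obtain p q :: int where pq: "q \<ge> 2" "\<bar>x $ k - of_int p / of_int q\<bar> \<le> 1 / of_int q ^ N"
        using x(1) unfolding Liouville_numbers_iff by blast
      define j where "j = nat (q - 2)"
      have q: "q = int (j + 2)"
        using pq(1) by (simp add: j_def)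
      have "1 / real_of_int q ^ N \<le> 1 / 1"
        using pq(1) by (intro divide_left_mono) auto
      moreover have "\<bar>x $ k\<bar> \<le> M"
        using x(2) by blast
      ultimately have "\<bar>of_int p / of_int q :: real\<bar> \<le> M + 1"
        using pq(2) by linarith
      hence "\<bar>of_int p :: real\<bar> \<le> (M + 1) * of_int q"
        using pq(1) by (simp add: abs_divide pos_divide_le_eq)
      also have "\<dots> = of_int (int (M + 1) * q)"
        by simp
      finally have "\<bar>p\<bar> \<le> int (M + 1) * q"
        by linarith
      hence "p \<in> P (j + 2)"
        unfolding P_def q by (simp add: abs_le_iff)
      moreover have "x \<in> slab (j + 2) p"
        using x(2) pq(2) by (simp add: slab_def q)
      ultimately show "x \<in> (\<Union>j. \<Union>p\<in>P (j + 2). slab (j + 2) p)"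
        by blast
    qed
    have row: "hausdorff_premeasure s \<delta> (\<Union>p\<in>P q. slab q p) \<le> ennreal (C * (1 / 2) ^ K * (1 / real q ^ 2))"
      if q: "q \<ge> 2" for q
    proof -
      define m where "m = q ^ N"
      have m: "m > 0"
        using q by (simp add: m_def)
      \<comment> \<open>Of the \<open>K + 3\<close> powers of \<open>q\<close>, one pays for the
        number of numerators, two give the summable \<open>1 / real q ^ 2\<close>, and the other
        \<open>K\<close> give \<open>(1 / 2) ^ K\<close> because \<open>q \<ge> 2\<close>.\<close>
      have "real q ^ (K + 3) = real q powr real (K + 3)"
        using q by (subst powr_realpow) auto
      also have "\<dots> \<le> real q powr (real N * t)"
        using N q by (intro powr_mono) auto
      also have "\<dots> = real m powr t"
        using q by (simp add: m_def powr_powr flip: powr_realpow)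
      finally have mt: "real q ^ (K + 3) \<le> real m powr t" .
      have "hausdorff_premeasure s \<delta> (\<Union>p\<in>P q. slab q p) \<le> (\<Sum>p\<in>P q. hausdorff_premeasure s \<delta> (slab q p))"
        using \<delta> by (intro hausdorff_premeasure_UN_le_sum) (auto simp: P_def)
      also have "\<dots> \<le> (\<Sum>p\<in>P q. ennreal (real (2 * M * m) ^ (?n - 1) * (2 * ?n / m) powr s))"
        unfolding slab_def m_def[symmetric] using N\<delta>[OF q] m M s0
        by (intro sum_mono hausdorff_premeasure_slab_le) (auto simp: m_def)
      also have "\<dots> = ennreal (real (card (P q)) * (real (2 * M * m) ^ (?n - 1) * (2 * ?n / m) powr s))"
        by (subst sum_ennreal) auto
      also have "\<dots> \<le> ennreal (C * (1 / 2) ^ K * (1 / real q ^ 2))"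
      proof (rule ennreal_leI)
        have "card (P q) = 2 * (M + 1) * q + 1"
          by (simp add: P_def nat_add_distrib nat_mult_distrib algebra_simps)
        hence cP: "real (card (P q)) \<le> (2 * M + 3) * real q"
          using q by (simp add: algebra_simps)
        have ms: "real m powr s = real m powr t * real m ^ (?n - 1)"
          unfolding st powr_add using m by (subst powr_realpow) auto
        have "(2 * ?n / m) powr s = (2 * ?n) powr s / (real m powr t * real m ^ (?n - 1))"
          using m by (simp add: powr_divide ms)
        hence "real (card (P q)) * (real (2 * M * m) ^ (?n - 1) * (2 * ?n / m) powr s)
            = real (card (P q)) * ((2 * M) ^ (?n - 1) * (2 * ?n) powr s / real m powr t)"
          using m by (simp add: power_mult_distrib)
        also have "\<dots> \<le> ((2 * M + 3) * real q) * ((2 * M) ^ (?n - 1) * (2 * ?n) powr s / real q ^ (K + 3))"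
          using cP mt q m by (intro mult_mono divide_left_mono mult_pos_pos) auto
        also have "\<dots> = C * (1 / real q ^ K) * (1 / real q ^ 2)"
          using q by (simp add: C_def power_add power2_eq_square power3_eq_cube field_simps)
        also have "\<dots> \<le> C * (1 / 2 ^ K) * (1 / real q ^ 2)"
          using q C by (intro mult_right_mono mult_left_mono divide_left_mono power_mono) auto
        finally show "real (card (P q)) * (real (2 * M * m) ^ (?n - 1) * (2 * ?n / m) powr s)
            \<le> C * (1 / 2) ^ K * (1 / real q ^ 2)"
          by (simp add: power_divide)
      qed
      finally show ?thesis .
    qed
    have "hausdorff_premeasure s \<delta> ?L \<le> (\<Sum>j. hausdorff_premeasure s \<delta> (\<Union>p\<in>P (j + 2). slab (j + 2) p))"
      using hausdorff_premeasure_mono[OF cover] hausdorff_premeasure_UN_le_suminf by (rule order_trans)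
    also have "\<dots> \<le> (\<Sum>j. ennreal (C * (1 / 2) ^ K * (1 / real (j + 2) ^ 2)))"
      by (intro suminf_le row) auto
    also have "\<dots> = ennreal (C * (1 / 2) ^ K * S)"
      using sums_mult[OF S, of "C * (1 / 2) ^ K"] C by (intro suminf_ennreal_eq) (auto simp: add.commute)
    finally show ?thesis .
  qed
  moreover have "(\<lambda>K. ennreal (C * (1 / 2) ^ K * S)) \<longlonglongrightarrow> ennreal (C * 0 * S)"
    by (intro tendsto_ennrealI tendsto_intros LIMSEQ_realpow_zero) auto
  ultimately have "hausdorff_premeasure s \<delta> ?L \<le> ennreal (C * 0 * S)"
    by (intro LIMSEQ_le_const) auto
  thus ?thesis
    by simp
qed

text \<open>The boxes of size \<open>Suc M\<close> exhaust the space, and the premeasure is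
  countably subadditive for each fixed \<delta>.\<close>

lemma hausdorff_measure_Liouville_component_eq_0:
  fixes k :: "'n::finite"
  assumes s: "s > real CARD('n) - 1"
  shows "hausdorff_measure s {x :: real ^ 'n. x $ k \<in> Liouville_numbers} = 0"
proof -
  have "hausdorff_premeasure s \<delta> {x :: real ^ 'n. x $ k \<in> Liouville_numbers} = 0" if \<delta>: "\<delta> > 0" for \<delta>
  proof -
    have "{x :: real ^ 'n. x $ k \<in> Liouville_numbers}
        \<subseteq> (\<Union>M. {x. x $ k \<in> Liouville_numbers \<and> (\<forall>i. \<bar>x $ i\<bar> \<le> Suc M)})"
    proof clarify
      fix x :: "real ^ 'n" assume x: "x $ k \<in> Liouville_numbers"
      obtain M where "norm x \<le> real M"
        using real_arch_simple by blast
      hence "\<bar>x $ i\<bar> \<le> Suc M" for i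
        using component_le_norm_cart[of x i] by simp
      thus "x \<in> (\<Union>M. {x. x $ k \<in> Liouville_numbers \<and> (\<forall>i. \<bar>x $ i\<bar> \<le> Suc M)})"
        using x by blast
    qed
    note le = order_trans[OF hausdorff_premeasure_mono[OF this, of s \<delta>] hausdorff_premeasure_UN_le_suminf]
    have null: "hausdorff_premeasure s \<delta> {x :: real ^ 'n. x $ k \<in> Liouville_numbers \<and> (\<forall>i. \<bar>x $ i\<bar> \<le> Suc M)} = 0" for M
      using s \<delta> by (rule hausdorff_premeasure_Liouville_box_eq_0) simp
    show ?thesis
      using le unfolding null by simp
  qed
  thus ?thesis
    by (simp add: hausdorff_measure_def)
qed

section \<open>Lower bound for the Hausdorff dimension\<close>

text \<open>
  To stay in one type, the image of a covering set under the difference map is thickened by the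
  unit interval in the \<open>k\<close>-th coordinate.
\<close>

lemma hausdorff_measure_neq_0_of_differences:
  fixes A :: "(real ^ 'n) set"
  assumes A: "\<And>y :: real ^ 'n. \<exists>x\<in>A. \<forall>j. j \<noteq> k \<longrightarrow> x $ j - x $ k = y $ j"
    and s: "0 \<le> s" "s \<le> real CARD('n) - 1" and n: "CARD('n) \<ge> 2"
  shows "hausdorff_measure s A \<noteq> 0"
proof -
  let ?n = "CARD('n)"
  \<comment> \<open>The measure is a supremum over \<delta>, so one scale suffices. Scale 1 ensures
    \<open>d i \<le> 1\<close>, so that lowering an exponent does not decrease a power of
    \<open>d i\<close>.\<close>
  have "1 / ennreal (4 ^ (?n - 1)) \<le> hausdorff_premeasure s 1 A"
    unfolding hausdorff_premeasure_def
  proof (rule INF_greatest)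
    fix U assume "U \<in> delta_covers 1 A"
    hence U: "A \<subseteq> (\<Union>i. U i)" "\<And>i. bounded (U i)" "\<And>i. diameter (U i) \<le> 1"
      by (auto simp: delta_covers_def)
    define u where "u = (\<lambda>i. SOME x. x \<in> U i)"
    have u: "u i \<in> U i" if "U i \<noteq> {}" for i
      using that by (simp add: u_def some_in_eq)
    define d where "d = (\<lambda>i. diameter (U i))"
    have d: "d i \<ge> 0" "d i \<le> 1" for i
      using U diameter_ge_0 by (auto simp: d_def)
    \<comment> \<open>Points of \<open>U i\<close> differ from \<open>u i\<close> by at most
      \<open>d i\<close> in each coordinate, so a difference of two coordinates varies by at most
      \<open>2 * d i\<close>. The box then has sides \<open>4 * d i\<close> off \<open>k\<close>,
      whence the constant \<open>4 ^ (?n - 1)\<close>.\<close>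
    define lo where "lo = (\<lambda>i. \<chi> j. if j = k then 0 else u i $ j - u i $ k - 2 * d i)"
    define hi where "hi = (\<lambda>i. \<chi> j. if j = k then 1 else u i $ j - u i $ k + 2 * d i)"
    define V where "V = (\<lambda>i. if U i = {} then {} else cbox (lo i) (hi i))"
    have meas: "emeasure lborel (V i) \<le> ennreal (4 ^ (?n - 1)) * diameter_gauge s (U i)" for i
    proof (cases "U i = {}")
      case False
      have "cbox (lo i) (hi i) \<noteq> {}"
        using d[of i] by (auto simp: interval_ne_empty_cart lo_def hi_def)
      hence "measure lborel (V i) = (\<Prod>j\<in>UNIV. hi i $ j - lo i $ j)"
        using False by (simp add: V_def content_cbox_cart)
      also have "\<dots> = (\<Prod>j\<in>UNIV. if j = k then 1 else 4 * d i)"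
        by (intro prod.cong) (auto simp: lo_def hi_def)
      also have "\<dots> = (4 * d i) ^ (?n - 1)"
        by (subst prod.remove[of _ k]) auto
      finally have "emeasure lborel (V i) = ennreal ((4 * d i) ^ (?n - 1))"
        using False emeasure_lborel_cbox_finite[of "lo i" "hi i"]
        by (subst emeasure_eq_ennreal_measure) (auto simp: V_def)
      also have "\<dots> = ennreal (4 ^ (?n - 1)) * ennreal (d i ^ (?n - 1))"
        using d by (simp add: power_mult_distrib ennreal_mult)
      also have "ennreal (d i ^ (?n - 1)) \<le> diameter_gauge s (U i)"
      proof (cases "s = 0")
        case True
        thus ?thesis
          using d[of i] False by (simp add: diameter_gauge_def power_le_one)
      next
        case s0: False
        have "d i ^ (?n - 1) \<le> d i powr s"
        \<comment> \<open>If \<open>d i = 0\<close>, the right side is \<open>0 powr s = 0\<close>;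
          the left side vanishes too because \<open>?n - 1 \<ge> 1\<close>.\<close>
        proof (cases "d i = 0")
          case False
          hence "d i ^ (?n - 1) = d i powr real (?n - 1)"
            using d[of i] by (subst powr_realpow) auto
          also have "\<dots> \<le> d i powr s"
            using d[of i] s n by (intro powr_mono') (auto simp: of_nat_diff)
          finally show ?thesis .
        qed (use n in \<open>simp add: power_0_left\<close>)
        thus ?thesis
          using False s0 by (simp add: diameter_gauge_def d_def ennreal_leI)
      qed
      finally show ?thesis
        by (simp add: mult_left_mono)
    qed (simp add: V_def)
    have "cbox 0 1 \<subseteq> (\<Union>i. V i)"
    proof
      fix y :: "real ^ 'n" assume y: "y \<in> cbox 0 1"
      \<comment> \<open>Differences match only the coordinates of \<open>y\<close> other than
        \<open>k\<close>; \<open>y $ k\<close> lies in the unit side of every nonempty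
        \<open>V i\<close>.\<close>
      obtain x where x: "x \<in> A" "\<And>j. j \<noteq> k \<Longrightarrow> x $ j - x $ k = y $ j"
        using A by blast
      then obtain i where i: "x \<in> U i"
        using U(1) by blast
      have "dist x (u i) \<le> d i"
        unfolding d_def using i u U(2) by (intro diameter_bounded_bound) auto
      hence c: "\<bar>x $ j - u i $ j\<bar> \<le> d i" for j
        using component_le_norm_cart[of "x - u i" j] by (simp add: dist_norm)
      have "lo i $ j \<le> y $ j \<and> y $ j \<le> hi i $ j" for j
      proof (cases "j = k")
        case True
        thus ?thesis
          using y by (auto simp: lo_def hi_def mem_box_cart)
      next
        case False
        thus ?thesis
          using x(2)[OF False] c[of j] c[of k] by (simp add: lo_def hi_def) linarith
      qed
      hence "y \<in> V i"
        using i by (auto simp: V_def mem_box_cart)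
      thus "y \<in> (\<Union>i. V i)"
        by blast
    qed
    hence "emeasure lborel (cbox (0 :: real ^ 'n) 1) \<le> emeasure lborel (\<Union>i. V i)"
      by (intro emeasure_mono) (auto simp: V_def)
    also have "\<dots> \<le> (\<Sum>i. emeasure lborel (V i))"
      by (intro emeasure_subadditive_countably) (auto simp: V_def)
    also have "\<dots> \<le> (\<Sum>i. ennreal (4 ^ (?n - 1)) * diameter_gauge s (U i))"
      by (intro suminf_le meas) auto
    also have "\<dots> = ennreal (4 ^ (?n - 1)) * (\<Sum>i. diameter_gauge s (U i))"
      by simp
    also have "emeasure lborel (cbox (0 :: real ^ 'n) 1) = 1"
      using emeasure_lborel_cbox_finite[of "0 :: real ^ 'n" 1]
      by (subst emeasure_eq_ennreal_measure) (auto simp: content_cbox_if_cart interval_eq_empty_cart)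
    finally show "1 / ennreal (4 ^ (?n - 1)) \<le> (\<Sum>i. diameter_gauge s (U i))"
      by (intro divide_le_posI_ennreal) (simp_all add: mult.commute)
  qed
  also have "\<dots> \<le> hausdorff_measure s A"
    unfolding hausdorff_measure_def by (rule SUP_upper) simp
  finally show ?thesis
    by (auto simp: ennreal_divide_eq_0_iff)
qed

lemma hausdorff_dim_Liouville_power:
  "hausdorff_dim {x :: real ^ 'n. \<forall>i. x $ i \<in> Liouville_numbers} = ereal (real CARD('n) - 1)"
proof (rule antisym)
  let ?L = "{x :: real ^ 'n. \<forall>i. x $ i \<in> Liouville_numbers}"
  have n: "CARD('n) \<ge> 1"
    by (simp add: Suc_leI)
  show "hausdorff_dim ?L \<le> ereal (real CARD('n) - 1)"
    unfolding hausdorff_dim_def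
  proof (rule ereal_le_epsilon2)
    fix e :: real assume e: "e > 0"
    let ?s = "real CARD('n) - 1 + e"
    \<comment> \<open>Any one coordinate serves: requiring only that one to be Liouville already
      gives a null set at exponent \<open>?s\<close>.\<close>
    fix k :: 'n
    have "hausdorff_measure ?s ?L \<le> hausdorff_measure ?s {x. x $ k \<in> Liouville_numbers}"
      unfolding hausdorff_measure_def by (intro SUP_mono' hausdorff_premeasure_mono) auto
    hence "hausdorff_measure ?s ?L = 0"
      using e by (simp add: hausdorff_measure_Liouville_component_eq_0)
    hence "(INF s\<in>{s. 0 \<le> s \<and> hausdorff_measure s ?L = 0}. ereal s) \<le> ereal ?s"
      using e n by (intro INF_lower) auto
    thus "(INF s\<in>{s. 0 \<le> s \<and> hausdorff_measure s ?L = 0}. ereal s) \<le> ereal (real CARD('n) - 1) + ereal e"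
      by simp
  qed
  show "ereal (real CARD('n) - 1) \<le> hausdorff_dim ?L"
    unfolding hausdorff_dim_def
  proof (rule INF_greatest, rule ccontr)
    fix s assume "s \<in> {s. 0 \<le> s \<and> hausdorff_measure s ?L = 0}" "\<not> ereal (real CARD('n) - 1) \<le> ereal s"
    hence s: "0 \<le> s" "hausdorff_measure s ?L = 0" "s < real CARD('n) - 1"
      by auto
    fix k :: 'n
    have "hausdorff_measure s ?L \<noteq> 0"
    proof (rule hausdorff_measure_neq_0_of_differences)
      fix y :: "real ^ 'n"
      \<comment> \<open>The point with coordinate \<open>z\<close> at \<open>k\<close> and
        \<open>z + y $ i\<close> elsewhere lies in the power and has the differences
        \<open>y $ i\<close>.\<close>
      obtain z where z: "\<And>i. z + (if i = k then 0 else y $ i) \<in> Liouville_numbers"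
        using Liouville_numbers_common_translate[of "\<lambda>i. if i = k then 0 else y $ i"] by blast
      show "\<exists>x\<in>?L. \<forall>j. j \<noteq> k \<longrightarrow> x $ j - x $ k = y $ j"
        by (rule bexI[of _ "\<chi> i. z + (if i = k then 0 else y $ i)"]) (use z in auto)
    \<comment> \<open>\<open>CARD('n) \<ge> 2\<close> follows from \<open>0 \<le> s\<close> and
      \<open>s < real CARD('n) - 1\<close>; in dimension 1 there is no such
      \<open>s\<close>.\<close>
    qed (use s in auto)
    with s(2) show False
      by simp
  qed
qed

theorem theorem2p1:
  fixes Ln :: "(real ^ 'n) set"
  defines "Ln \<equiv> {x. \<forall>i. x $ i \<in> Liouville_numbers}"
  shows "hausdorff_dim Ln = ereal (real CARD('n) - 1) \<and>
         packing_dim Ln = ereal (real CARD('n))"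
  unfolding Ln_def by (simp add: hausdorff_dim_Liouville_power packing_dim_Liouville_power)

end
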